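(* Consider the tree dyadic model with repeated coefficients (RCM), let $u$ be its constant solution, and let $F_j$, $\sigma_j$ and $\varphi$ be defined as in the context. For every set $B\subset\mathbb R$ of which $\varphi(3/2)$ is an interior point, $$\lim_{n\to\infty}\sum_{|j|=n}F_j\,\mathbf 1_{\{\sigma_j\in B\}}=1.$$
   Context: Tree: let $d\ge1$ be an integer, $N=2^d$. $J=\bigcup_{n\ge0}\{1,\dots,N\}^n$ is the set of finite words, $\emptyset$ the empty word, $|j|$ the length of $j$; $j\le k$ means $j$ is a prefix of $k$; for $j\neq\emptyset$, $\bar\jmath$ is $j$ with its last letter removed; $\mathcal O_j=\{k\in J:\bar k=j\}$. Coefficients: $\alpha>0$, $f>0$, positive $(d_j)_{j\in J}$ with $d_\emptyset=1$, and $c_j=d_j2^{\alpha|j|}$. RCM: there is a family $\{\delta_\omega:\omega\in\Omega\}$ of positive numbers, $|\Omega|=N$, such that for every $j\in J$ the multiset $\{d_k:k\in\mathcal O_j\}$ equals $\{\delta_\omega:\omega\in\Omega\}$ (with multiplicities). For $s\ne0$, $\ell_s=\frac1s\log_2\bigl(\frac1N\sum_\omega\delta_\omega^s\bigr)$. Constant solution of the RCM (of the system $v_j'=c_jv_{\bar\jmath}^2-\sum_{k\in\mathcal O_j}c_kv_jv_k$ with $v_{\bar\emptyset}\equiv f$): $$u_j=f\,2^{q|j|+q}\prod_{k\le j}\sqrt{d_k},\quad j\in J,\qquad q=-\frac13(\alpha+d)-\frac12\ell_{3/2},\qquad u_{\bar\emptyset}=f.$$ Fraction of anomalous dissipation in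 node $j$: $$F_j=\frac{2c_ju_{\bar\jmath}^2u_j}{2c_\emptyset u_{\bar\emptyset}^2u_\emptyset}=\frac1{2^qf^3}c_ju_{\bar\jmath}^2u_j.$$ For $j\ne\emptyset$, $\sigma_j=\frac1{|j|}\sum_{k\le j}\log_2d_k$. For $\gamma\in\mathbb R$, $\varphi(\gamma)=\sum_\omega\frac{\delta_\omega^\gamma}{\sum_v\delta_v^\gamma}\log_2\delta_\omega$. *)

theory Defs
  imports "HOL-Analysis.Analysis" "HOL-Library.Multiset" "HOL-Library.Sublist"
begin

text \<open>
  The integer called \<open>d\<close> on paper is \<open>m\<close> here, as \<open>d\<close> denotes the node coefficients.
  Nodes of the tree are finite words over \<open>{1..2 ^ m}\<close>; new letters are appended on the right,
  so the parent of a nonempty word is its \<^const>\<open>butlast\<close> and the tree order is \<^const>\<open>prefix\<close>.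
\<close>

definition tree_nodes :: "nat \<Rightarrow> nat list set" where
  "tree_nodes m = lists {1..2 ^ m}"

definition offspring :: "nat \<Rightarrow> nat list \<Rightarrow> nat list set" where
  "offspring m j = {k \<in> tree_nodes m. k \<noteq> [] \<and> butlast k = j}"

definition node_coeff :: "real \<Rightarrow> (nat list \<Rightarrow> real) \<Rightarrow> nat list \<Rightarrow> real" where
  "node_coeff \<alpha> d j = d j * 2 powr (\<alpha> * real (length j))"

text \<open>The family \<open>\<delta>\<close> is indexed by \<open>\<Omega>\<close>; the values on sibling nodes are compared as multisets.\<close>

locale repeated_coefficients_model =
  fixes m :: nat and \<alpha> f :: real and d :: "nat list \<Rightarrow> real"
    and \<Omega> :: "'w set" and \<delta> :: "'w \<Rightarrow> real"
  assumes m_ge_1: "m \<ge> 1"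
    and alpha_pos: "\<alpha> > 0"
    and force_pos: "f > 0"
    and d_pos: "\<And>j. j \<in> tree_nodes m \<Longrightarrow> d j > 0"
    and d_root: "d [] = 1"
    and finite_Omega: "finite \<Omega>"
    and card_Omega: "card \<Omega> = 2 ^ m"
    and delta_pos: "\<And>\<omega>. \<omega> \<in> \<Omega> \<Longrightarrow> \<delta> \<omega> > 0"
    and repeated: "\<And>j. j \<in> tree_nodes m \<Longrightarrow>
      image_mset d (mset_set (offspring m j)) = image_mset \<delta> (mset_set \<Omega>)"

text \<open>Only meaningful for \<open>s \<noteq> 0\<close>.\<close>

definition rcm_ell :: "nat \<Rightarrow> 'w set \<Rightarrow> ('w \<Rightarrow> real) \<Rightarrow> real \<Rightarrow> real" where
  "rcm_ell m \<Omega> \<delta> s = 1 / s * log 2 (1 / 2 ^ m * (\<Sum>\<omega>\<in>\<Omega>. \<delta> \<omega> powr s))"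

definition growth_exponent :: "nat \<Rightarrow> real \<Rightarrow> 'w set \<Rightarrow> ('w \<Rightarrow> real) \<Rightarrow> real" where
  "growth_exponent m \<alpha> \<Omega> \<delta> = - (1 / 3) * (\<alpha> + real m) - 1 / 2 * rcm_ell m \<Omega> \<delta> (3 / 2)"

definition constant_solution ::
  "nat \<Rightarrow> real \<Rightarrow> real \<Rightarrow> (nat list \<Rightarrow> real) \<Rightarrow> 'w set \<Rightarrow> ('w \<Rightarrow> real) \<Rightarrow> nat list \<Rightarrow> real" where
  "constant_solution m \<alpha> f d \<Omega> \<delta> j =
    (let q = growth_exponent m \<alpha> \<Omega> \<delta>
     in f * 2 powr (q * real (length j) + q) * (\<Prod>k | prefix k j. sqrt (d k)))"

text \<open>The value at the parent of a node, where the fictitious parent of the root carries the force \<open>f\<close>.\<close>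

definition at_parent :: "real \<Rightarrow> (nat list \<Rightarrow> real) \<Rightarrow> nat list \<Rightarrow> real" where
  "at_parent f u j = (if j = [] then f else u (butlast j))"

definition dissipation_fraction ::
  "real \<Rightarrow> (nat list \<Rightarrow> real) \<Rightarrow> (nat list \<Rightarrow> real) \<Rightarrow> nat list \<Rightarrow> real" where
  "dissipation_fraction f c u j =
    (2 * c j * (at_parent f u j)\<^sup>2 * u j) / (2 * c [] * (at_parent f u [])\<^sup>2 * u [])"

text \<open>Only meaningful for \<open>j \<noteq> []\<close>. The sum has \<open>length j + 1\<close> terms, the one at the root being
  zero when \<open>d [] = 1\<close>.\<close>

definition rcm_sigma :: "(nat list \<Rightarrow> real) \<Rightarrow> nat list \<Rightarrow> real" where
  "rcm_sigma d j = 1 / real (length j) * (\<Sum>k | prefix k j. log 2 (d k))"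

definition rcm_phi :: "'w set \<Rightarrow> ('w \<Rightarrow> real) \<Rightarrow> real \<Rightarrow> real" where
  "rcm_phi \<Omega> \<delta> \<gamma> = (\<Sum>\<omega>\<in>\<Omega>. \<delta> \<omega> powr \<gamma> / (\<Sum>v\<in>\<Omega>. \<delta> v powr \<gamma>) * log 2 (\<delta> \<omega>))"

text \<open>The closed formula does give a stationary point of
  \<open>v\<^sub>j' = c\<^sub>j (v at parent of j)\<^sup>2 - (\<Sum>k\<in>offspring j. c\<^sub>k v\<^sub>j v\<^sub>k)\<close>, and the normalisation of
  \<^const>\<open>dissipation_fraction\<close> is \<open>1 / (2\<^sup>q f\<^sup>3)\<close>.\<close>

context repeated_coefficients_model
begin

abbreviation "q \<equiv> growth_exponent m \<alpha> \<Omega> \<delta>"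
abbreviation "c \<equiv> node_coeff \<alpha> d"
abbreviation "u \<equiv> constant_solution m \<alpha> f d \<Omega> \<delta>"

lemma constant_solution_step:
  assumes "j \<in> tree_nodes m"
  shows "u j = 2 powr q * sqrt (d j) * at_parent f u j"
proof (cases j rule: rev_cases)
  case Nil
  then show ?thesis
    by (simp add: constant_solution_def at_parent_def d_root Let_def)
next
  case (snoc i a)
  have fin: "finite {k. prefix k i}"
    by (simp add: set_prefixes_eq [symmetric])
  have "{k. prefix k j} = insert j {k. prefix k i}"
    using snoc by auto
  moreover have "j \<notin> {k. prefix k i}"
    using snoc by (auto dest: prefix_length_le)
  ultimately have "(\<Prod>k | prefix k j. sqrt (d k)) = sqrt (d j) * (\<Prod>k | prefix k i. sqrt (d k))"
    using fin by simp
  moreover have "2 powr (q * real (length j) + q) = 2 powr q * 2 powr (q * real (length i) + q)"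
    using snoc by (simp add: powr_add [symmetric] algebra_simps)
  moreover have "at_parent f u j = u i"
    using snoc by (simp add: at_parent_def)
  ultimately show ?thesis
    by (simp add: constant_solution_def Let_def)
qed

lemma constant_solution_stationary:
  assumes j: "j \<in> tree_nodes m"
  shows "c j * (at_parent f u j)\<^sup>2 - (\<Sum>k\<in>offspring m j. c k * u j * u k) = 0"
proof -
  define S where "S = (\<Sum>\<omega>\<in>\<Omega>. \<delta> \<omega> powr (3/2))"
  define L where "L = 2 powr (\<alpha> * (real (length j) + 1))"
  have ne: "\<Omega> \<noteq> {}" using card_Omega by auto
  have S_pos: "S > 0"
    unfolding S_def using ne finite_Omega delta_pos by (intro sum_pos) force+
  have "(\<Sum>k\<in>offspring m j. d k powr (3/2)) =
      sum_mset (image_mset (\<lambda>x. x powr (3/2)) (image_mset d (mset_set (offspring m j))))"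
    by (simp add: sum_unfold_sum_mset image_mset.compositionality comp_def)
  also have "\<dots> = S"
    by (simp add: repeated [OF j] S_def sum_unfold_sum_mset image_mset.compositionality comp_def)
  finally have sum_d: "(\<Sum>k\<in>offspring m j. d k powr (3/2)) = S" .
  have term_eq: "c k * u j * u k = L * 2 powr q * (u j)\<^sup>2 * d k powr (3/2)"
    if k: "k \<in> offspring m j" for k
  proof -
    have kn: "k \<in> tree_nodes m" "k \<noteq> []" "butlast k = j"
      using k by (auto simp: offspring_def)
    have "length k = length j + 1"
      using kn by (metis length_append_singleton append_butlast_last_id Suc_eq_plus1)
    moreover have "d k powr (3/2) = d k * sqrt (d k)"
      using d_pos [OF kn(1)] powr_add [of "d k" 1 "1/2"] by (simp add: powr_half_sqrt)
    moreover have "u k = 2 powr q * sqrt (d k) * u j"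
      using constant_solution_step [OF kn(1)] kn by (simp add: at_parent_def)
    ultimately show ?thesis
      by (simp add: node_coeff_def L_def power2_eq_square algebra_simps)
  qed
  have "log 2 (1 / 2 ^ m * S) = log 2 S - real m"
    using S_pos by (simp add: log_divide)
  then have "q * 3 = - \<alpha> - log 2 S"
    by (simp add: growth_exponent_def rcm_ell_def S_def [symmetric] field_simps)
  then have "2 powr (q * 3) = 2 powr (- \<alpha>) / S"
    using S_pos by (simp add: powr_diff)
  then have q3: "2 powr q * 2 powr q * 2 powr q * S = 2 powr (- \<alpha>)"
    using S_pos by (simp add: powr_add [symmetric] mult.commute)
  have LA: "L * 2 powr (- \<alpha>) = 2 powr (\<alpha> * real (length j))"
    by (simp add: L_def powr_add [symmetric] algebra_simps)
  have "(\<Sum>k\<in>offspring m j. c k * u j * u k) = L * 2 powr q * (u j)\<^sup>2 * S"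
    using term_eq sum_d by (simp add: sum_distrib_left [symmetric])
  also have "(u j)\<^sup>2 = (2 powr q * 2 powr q) * d j * (at_parent f u j)\<^sup>2"
    using constant_solution_step [OF j] d_pos [OF j] by (simp add: power_mult_distrib power2_eq_square)
  also have "L * 2 powr q * ((2 powr q * 2 powr q) * d j * (at_parent f u j)\<^sup>2) * S =
      L * (2 powr q * 2 powr q * 2 powr q * S) * d j * (at_parent f u j)\<^sup>2"
    by (simp add: algebra_simps)
  also have "\<dots> = c j * (at_parent f u j)\<^sup>2"
    by (simp add: q3 LA node_coeff_def)
  finally show ?thesis by simp
qed

lemma dissipation_fraction_eq:
  "dissipation_fraction f c u j = 1 / (2 powr q * f ^ 3) * c j * (at_parent f u j)\<^sup>2 * u j"
proof -
  have "u [] = f * 2 powr q" "c [] = 1"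
    by (simp_all add: constant_solution_def node_coeff_def d_root)
  then show ?thesis
    by (simp add: dissipation_fraction_def at_parent_def power2_eq_square power3_eq_cube ac_simps)
qed

end

end

theory Submission
  imports Defs
begin

text \<open>
  Passing from a node \<open>j\<close> to an offspring \<open>k\<close> multiplies the dissipation fraction by
  \<open>p\<^sub>k = d\<^sub>k\<^sup>3\<^sup>/\<^sup>2 / (\<Sum>\<omega>. \<delta>\<^sub>\<omega>\<^sup>3\<^sup>/\<^sup>2)\<close>, and these weights sum to one over the offspring. So on each
  generation the fractions are the law of a branch chosen at random, along which the increments
  \<open>log\<^sub>2 d\<^sub>k\<close> are i.i.d. with mean \<open>\<phi>(3/2)\<close>. The variance of their sum is linear in the
  generation, so Chebyshev's inequality yields the weak law of large numbers for \<open>\<sigma>\<close>.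
\<close>

section \<open>Prefix sums and the generations of the tree\<close>

lemma sum_prefixes_snoc:
  fixes g :: "'a list \<Rightarrow> real"
  shows "(\<Sum>k | prefix k (i @ [a]). g k) = g (i @ [a]) + (\<Sum>k | prefix k i. g k)"
proof -
  have "finite {k. prefix k i}"
    by (simp add: set_prefixes_eq [symmetric])
  moreover have "{k. prefix k (i @ [a])} = insert (i @ [a]) {k. prefix k i}"
    by auto
  moreover have "i @ [a] \<notin> {k. prefix k i}"
    by (auto dest: prefix_length_le)
  ultimately show ?thesis
    by simp
qed

definition tree_level :: "nat \<Rightarrow> nat \<Rightarrow> nat list set" where
  "tree_level m n = {j. j \<in> tree_nodes m \<and> length j = n}"

lemma tree_level_0 [simp]: "tree_level m 0 = {[]}"
  by (auto simp: tree_level_def tree_nodes_def)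

lemma finite_tree_level: "finite (tree_level m n)"
  using finite_lists_length_eq [of "{1..2 ^ m :: nat}" n]
  by (simp add: tree_level_def tree_nodes_def lists_eq_set)

lemma tree_level_Suc: "tree_level m (Suc n) = (\<Union>j\<in>tree_level m n. offspring m j)"
proof
  show "tree_level m (Suc n) \<subseteq> (\<Union>j\<in>tree_level m n. offspring m j)"
  proof
    fix k assume k: "k \<in> tree_level m (Suc n)"
    then obtain i a where "k = i @ [a]"
      by (cases k rule: rev_cases) (auto simp: tree_level_def)
    with k show "k \<in> (\<Union>j\<in>tree_level m n. offspring m j)"
      by (auto simp: tree_level_def tree_nodes_def offspring_def)
  qed
  show "(\<Union>j\<in>tree_level m n. offspring m j) \<subseteq> tree_level m (Suc n)"
    by (auto simp: tree_level_def offspring_def)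
qed

text \<open>The offspring sets of distinct nodes are disjoint, as a node determines its parent.
  Inductions over \<open>n\<close> thereby reduce to a computation at a single node.\<close>

lemma sum_tree_level_Suc:
  fixes g :: "nat list \<Rightarrow> real"
  shows "(\<Sum>k\<in>tree_level m (Suc n). g k) = (\<Sum>j\<in>tree_level m n. \<Sum>k\<in>offspring m j. g k)"
proof -
  have "finite (offspring m j)" if "j \<in> tree_level m n" for j
    using finite_subset [OF _ finite_tree_level [of m "Suc n"]] that
    by (auto simp: tree_level_Suc)
  moreover have "offspring m i \<inter> offspring m j = {}" if "i \<noteq> j" for i j
    using that by (auto simp: offspring_def)
  ultimately show ?thesis
    by (simp add: tree_level_Suc sum.UNION_disjoint finite_tree_level)
qed

section \<open>Dissipation fractions as a probability on each generation\<close>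

context repeated_coefficients_model
begin

abbreviation "F \<equiv> dissipation_fraction f c u"
abbreviation "Z \<equiv> (\<Sum>v\<in>\<Omega>. \<delta> v powr (3/2))"
abbreviation "\<phi> \<equiv> rcm_phi \<Omega> \<delta> (3/2)"

lemma Z_pos: "Z > 0"
proof -
  have "\<Omega> \<noteq> {}"
    using card_Omega by auto
  then show ?thesis
    using finite_Omega delta_pos by (intro sum_pos) force+
qed

text \<open>The right-hand side does not depend on \<open>j\<close>: this is what makes the
  increments along a random branch identically distributed and independent of the past.\<close>

lemma sum_offspring:
  fixes g :: "real \<Rightarrow> real"
  assumes "j \<in> tree_nodes m"
  shows "(\<Sum>k\<in>offspring m j. g (d k)) = (\<Sum>\<omega>\<in>\<Omega>. g (\<delta> \<omega>))"
proof -
  have "(\<Sum>k\<in>offspring m j. g (d k)) =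
      sum_mset (image_mset g (image_mset d (mset_set (offspring m j))))"
    by (simp add: sum_unfold_sum_mset image_mset.compositionality comp_def)
  then show ?thesis
    by (simp add: repeated [OF assms] sum_unfold_sum_mset image_mset.compositionality comp_def)
qed

lemma dissipation_fraction_root: "F [] = 1"
  using force_pos by (simp add: dissipation_fraction_def node_coeff_def d_root at_parent_def
      constant_solution_def prod_pos)

text \<open>Up to the same constant, \<open>F j\<close> is \<open>u j\<close> times the inflow of
  \<open>j\<close>, and \<open>F k\<close> is \<open>u j\<close> times the flow from
  \<open>j\<close> to \<open>k\<close>. Their ratio is the share of \<open>k\<close> in the total
  outflow, and each flow is proportional to \<open>d k powr (3/2)\<close>: a factor
  \<open>d k\<close> from \<open>c k\<close> and a square root from \<open>u k\<close>.\<close>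

lemma dissipation_fraction_offspring:
  assumes j: "j \<in> tree_nodes m" and k: "k \<in> offspring m j"
  shows "F k = F j * (d k powr (3/2) / Z)"
proof -
  \<comment> \<open>\<open>C\<close> gathers what siblings share; one factor \<open>u j\<close>
    belongs to the flow itself, the other comes from the recursion for \<open>u i\<close>.\<close>
  define C where "C = 2 powr (\<alpha> * (real (length j) + 1)) * 2 powr q * (u j)\<^sup>2"
  have flow: "c i * u j * u i = C * d i powr (3/2)" and parent: "at_parent f u i = u j"
    if i: "i \<in> offspring m j" for i
  proof -
    have it: "i \<in> tree_nodes m" "i \<noteq> []" "butlast i = j"
      using i by (auto simp: offspring_def)
    have len: "length i = length j + 1"
      using it by (metis length_append_singleton append_butlast_last_id Suc_eq_plus1)
    show ap: "at_parent f u i = u j"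
      using it by (simp add: at_parent_def)
    have "d i powr (3/2) = d i * sqrt (d i)"
      using d_pos [OF it(1)] powr_add [of "d i" 1 "1/2"] by (simp add: powr_half_sqrt)
    then show "c i * u j * u i = C * d i powr (3/2)"
      by (simp add: constant_solution_step [OF it(1)] ap len node_coeff_def C_def
          power2_eq_square algebra_simps)
  qed
  \<comment> \<open>Stationarity fixes the constant of proportionality, so \<open>q\<close> need not be computed.\<close>
  have "c j * (at_parent f u j)\<^sup>2 = (\<Sum>i\<in>offspring m j. C * d i powr (3/2))"
    using constant_solution_stationary [OF j] flow by simp
  also have "\<dots> = C * Z"
    using sum_offspring [OF j, of "\<lambda>x. x powr (3/2)"] by (simp add: sum_distrib_left [symmetric])
  finally have CZ: "c j * (at_parent f u j)\<^sup>2 = C * Z" .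
  have "F k = 1 / (2 powr q * f ^ 3) * (c k * u j * u k) * u j"
    by (simp add: dissipation_fraction_eq parent [OF k] power2_eq_square algebra_simps)
  also have "\<dots> = 1 / (2 powr q * f ^ 3) * (C * Z) * u j * (d k powr (3/2) / Z)"
    using Z_pos by (simp add: flow [OF k])
  also have "\<dots> = F j * (d k powr (3/2) / Z)"
    by (simp only: dissipation_fraction_eq CZ [symmetric] mult.assoc)
  finally show ?thesis .
qed

lemma dissipation_fraction_nonneg:
  assumes "j \<in> tree_nodes m"
  shows "F j \<ge> 0"
  using assms
proof (induction j rule: rev_induct)
  case Nil
  then show ?case
    by (simp add: dissipation_fraction_root)
next
  case (snoc a i)
  then have i: "i \<in> tree_nodes m" and "i @ [a] \<in> offspring m i"
    by (auto simp: tree_nodes_def offspring_def)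
  then show ?case
    using snoc.IH [OF i] Z_pos by (simp add: dissipation_fraction_offspring [of i "i @ [a]"])
qed

text \<open>One-step conditional expectation: on a branch through \<open>j\<close>, the next
  coefficient is \<open>\<delta> \<omega>\<close> with probability
  \<open>\<delta> \<omega> powr (3/2) / Z\<close>.\<close>

lemma sum_dissipation_offspring:
  fixes g :: "real \<Rightarrow> real"
  assumes "j \<in> tree_nodes m"
  shows "(\<Sum>k\<in>offspring m j. F k * g (d k)) = F j * (\<Sum>\<omega>\<in>\<Omega>. \<delta> \<omega> powr (3/2) / Z * g (\<delta> \<omega>))"
proof -
  have "(\<Sum>k\<in>offspring m j. F k * g (d k)) =
      F j * (\<Sum>k\<in>offspring m j. d k powr (3/2) / Z * g (d k))"
    unfolding sum_distrib_left
    by (rule sum.cong) (simp_all add: dissipation_fraction_offspring [OF assms])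
  then show ?thesis
    by (simp only: sum_offspring [OF assms, of "\<lambda>x. x powr (3/2) / Z * g x"])
qed

lemma sum_weights: "(\<Sum>\<omega>\<in>\<Omega>. \<delta> \<omega> powr (3/2) / Z) = 1"
  using Z_pos by (simp add: sum_divide_distrib [symmetric])

lemma sum_dissipation_level: "(\<Sum>j\<in>tree_level m n. F j) = 1"
proof (induction n)
  case 0
  then show ?case
    by (simp add: dissipation_fraction_root)
next
  case (Suc n)
  have "(\<Sum>k\<in>offspring m j. F k) = F j" if "j \<in> tree_level m n" for j
    using sum_dissipation_offspring [of j "\<lambda>_. 1"] that sum_weights by (simp add: tree_level_def)
  then show ?case
    using Suc by (simp add: sum_tree_level_Suc)
qed

section \<open>Variance along a random branch\<close>

text \<open>The centred random walk. For nonempty \<open>j\<close> it is \<open>length j\<close>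
  times \<open>rcm_sigma d j - \<phi>\<close>; without the division it is additive along
  branches.\<close>

definition deviation :: "nat list \<Rightarrow> real" where
  "deviation j = (\<Sum>k | prefix k j. log 2 (d k)) - real (length j) * \<phi>"

definition step_variance :: real where
  "step_variance = (\<Sum>\<omega>\<in>\<Omega>. \<delta> \<omega> powr (3/2) / Z * (log 2 (\<delta> \<omega>) - \<phi>)\<^sup>2)"

lemma deviation_offspring:
  assumes "k \<in> offspring m j"
  shows "deviation k = deviation j + (log 2 (d k) - \<phi>)"
proof -
  obtain a where "k = j @ [a]"
    using assms by (metis (lifting) offspring_def mem_Collect_eq append_butlast_last_id)
  then show ?thesis
    by (simp add: deviation_def sum_prefixes_snoc algebra_simps del: prefix_snoc)
qed

text \<open>Variances of independent centred increments add: after expanding the square, the cross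
  term vanishes.\<close>

lemma sum_dissipation_deviation_sq:
  "(\<Sum>j\<in>tree_level m n. F j * (deviation j)\<^sup>2) = real n * step_variance"
proof (induction n)
  case 0
  \<comment> \<open>As \<open>d [] = 1\<close>, the root contributes no increment, so generation
    \<open>n\<close> carries exactly \<open>n\<close> of them.\<close>
  then show ?case
    by (simp add: deviation_def d_root)
next
  case (Suc n)
  have "(\<Sum>k\<in>offspring m j. F k * (deviation k)\<^sup>2) = F j * (deviation j)\<^sup>2 + F j * step_variance"
    if "j \<in> tree_level m n" for j
  proof -
    define p where "p = (\<lambda>\<omega>. \<delta> \<omega> powr (3/2) / Z)"
    define X where "X = (\<lambda>\<omega>. log 2 (\<delta> \<omega>) - \<phi>)"
    have j: "j \<in> tree_nodes m"
      using that by (simp add: tree_level_def)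
    have total: "(\<Sum>\<omega>\<in>\<Omega>. p \<omega>) = 1"
      using sum_weights by (simp add: p_def)
    have var: "(\<Sum>\<omega>\<in>\<Omega>. p \<omega> * (X \<omega>)\<^sup>2) = step_variance"
      by (simp add: p_def X_def step_variance_def)
    have "(\<Sum>\<omega>\<in>\<Omega>. p \<omega> * X \<omega>) = (\<Sum>\<omega>\<in>\<Omega>. p \<omega> * log 2 (\<delta> \<omega>)) - (\<Sum>\<omega>\<in>\<Omega>. p \<omega>) * \<phi>"
      by (simp add: X_def algebra_simps sum_subtractf sum_distrib_right)
    \<comment> \<open>By definition \<open>\<phi>\<close> is the mean of
      \<open>log 2 (\<delta> \<omega>)\<close> under the weights \<open>p\<close>.\<close>
    then have centred: "(\<Sum>\<omega>\<in>\<Omega>. p \<omega> * X \<omega>) = 0"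
      using total by (simp add: p_def rcm_phi_def)
    have "(\<Sum>k\<in>offspring m j. F k * (deviation k)\<^sup>2) =
        (\<Sum>k\<in>offspring m j. F k * (deviation j + (log 2 (d k) - \<phi>))\<^sup>2)"
      by (rule sum.cong) (simp_all add: deviation_offspring [of _ j])
    also have "\<dots> = F j * (\<Sum>\<omega>\<in>\<Omega>. p \<omega> * (deviation j + X \<omega>)\<^sup>2)"
      using sum_dissipation_offspring [OF j, of "\<lambda>x. (deviation j + (log 2 x - \<phi>))\<^sup>2"]
      by (simp add: p_def X_def)
    also have "(\<Sum>\<omega>\<in>\<Omega>. p \<omega> * (deviation j + X \<omega>)\<^sup>2) = (\<Sum>\<omega>\<in>\<Omega>. (deviation j)\<^sup>2 * p \<omega>
        + (2 * deviation j) * (p \<omega> * X \<omega>) + p \<omega> * (X \<omega>)\<^sup>2)"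
      by (rule sum.cong) (simp_all add: power2_eq_square algebra_simps)
    also have "\<dots> = (deviation j)\<^sup>2 + step_variance"
      by (simp only: sum.distrib sum_distrib_left [symmetric] centred total var)
    finally show ?thesis
      by (simp add: distrib_left)
  qed
  then show ?case
    using Suc sum_dissipation_level [of n]
    by (simp add: sum_tree_level_Suc sum.distrib sum_distrib_right [symmetric] distrib_right)
qed

section \<open>Chebyshev's inequality and the limit\<close>

lemma dissipation_chebyshev:
  assumes "n > 0" "e > 0"
    and ball: "\<And>x. \<bar>x - \<phi>\<bar> < e \<Longrightarrow> x \<in> B"
  shows "(\<Sum>j\<in>tree_level m n. F j * indicator B (rcm_sigma d j)) \<ge>
    1 - step_variance / e\<^sup>2 / real n"
proof -
  have "F j - F j * (deviation j)\<^sup>2 / (real n * e)\<^sup>2 \<le> F j * indicator B (rcm_sigma d j)"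
    if j: "j \<in> tree_level m n" for j
  proof -
    \<comment> \<open>A quadratic minorant of the indicator: it never exceeds 1, and off
      \<open>B\<close> it is at most 0 because there \<open>deviation j\<close> is at least
      \<open>real n * e\<close> in absolute value.\<close>
    have "1 - (deviation j)\<^sup>2 / (real n * e)\<^sup>2 \<le> (indicator B (rcm_sigma d j) :: real)"
    proof (cases "rcm_sigma d j \<in> B")
      case False
      have "deviation j = real n * (rcm_sigma d j - \<phi>)"
        using j \<open>n > 0\<close> by (simp add: deviation_def rcm_sigma_def tree_level_def algebra_simps)
      moreover have "\<bar>rcm_sigma d j - \<phi>\<bar> \<ge> e"
        using ball False by force
      ultimately have "\<bar>deviation j\<bar> \<ge> \<bar>real n * e\<bar>"
        using assms by (simp add: abs_mult)
      then have "(deviation j)\<^sup>2 \<ge> (real n * e)\<^sup>2"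
        by (simp only: abs_le_square_iff)
      then show ?thesis
        using assms False by simp
    qed simp
    then have "F j * (1 - (deviation j)\<^sup>2 / (real n * e)\<^sup>2) \<le> F j * indicator B (rcm_sigma d j)"
      using j dissipation_fraction_nonneg by (intro mult_left_mono) (auto simp: tree_level_def)
    then show ?thesis
      by (simp add: algebra_simps)
  qed
  then have "(\<Sum>j\<in>tree_level m n. F j - F j * (deviation j)\<^sup>2 / (real n * e)\<^sup>2) \<le>
      (\<Sum>j\<in>tree_level m n. F j * indicator B (rcm_sigma d j))"
    by (rule sum_mono)
  moreover have "(\<Sum>j\<in>tree_level m n. F j - F j * (deviation j)\<^sup>2 / (real n * e)\<^sup>2) =
      1 - real n * step_variance / (real n * e)\<^sup>2"
    by (simp only: sum_subtractf sum_divide_distrib [symmetric] sum_dissipation_level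
        sum_dissipation_deviation_sq)
  moreover have "real n * step_variance / (real n * e)\<^sup>2 = step_variance / e\<^sup>2 / real n"
    using assms by (simp add: power2_eq_square)
  ultimately show ?thesis
    by simp
qed

lemma dissipation_concentrates:
  assumes "\<phi> \<in> interior B"
  shows "(\<lambda>n. \<Sum>j\<in>tree_level m n. F j * indicator B (rcm_sigma d j)) \<longlonglongrightarrow> 1"
proof -
  obtain e where e: "e > 0" "ball \<phi> e \<subseteq> B"
    using assms by (auto simp: mem_interior)
  have B: "x \<in> B" if "\<bar>x - \<phi>\<bar> < e" for x
    using that e(2) by (auto simp: dist_real_def abs_minus_commute)
  show ?thesis
  proof (rule tendsto_sandwich)
    show "\<forall>\<^sub>F n in sequentially. 1 - step_variance / e\<^sup>2 / real n \<le>
        (\<Sum>j\<in>tree_level m n. F j * indicator B (rcm_sigma d j))"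
      \<comment> \<open>Generation 0 is excluded: at the root \<open>rcm_sigma\<close> divides by
        zero and takes the default value 0.\<close>
      using eventually_gt_at_top [of 0]
      by eventually_elim (rule dissipation_chebyshev [OF _ e(1) B])
    have "(\<Sum>j\<in>tree_level m n. F j * indicator B (rcm_sigma d j)) \<le> 1" for n
    proof -
      have "(\<Sum>j\<in>tree_level m n. F j * indicator B (rcm_sigma d j)) \<le> (\<Sum>j\<in>tree_level m n. F j)"
        using dissipation_fraction_nonneg
        by (intro sum_mono) (auto simp: tree_level_def indicator_def)
      then show ?thesis
        by (simp add: sum_dissipation_level)
    qed
    then show "\<forall>\<^sub>F n in sequentially.
        (\<Sum>j\<in>tree_level m n. F j * indicator B (rcm_sigma d j)) \<le> 1"
      by simp
    show "(\<lambda>n. 1 - step_variance / e\<^sup>2 / real n) \<longlonglongrightarrow> 1"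
      using tendsto_diff [OF tendsto_const lim_const_over_n [of "step_variance / e\<^sup>2"], of 1]
      by simp
  qed simp
qed

end

theorem theorem5p3:
  fixes m :: nat and \<alpha> f :: real and d :: "nat list \<Rightarrow> real"
    and \<Omega> :: "'w set" and \<delta> :: "'w \<Rightarrow> real" and B :: "real set"
  assumes "repeated_coefficients_model m \<alpha> f d \<Omega> \<delta>"
    and "rcm_phi \<Omega> \<delta> (3 / 2) \<in> interior B"
  shows "(\<lambda>n. \<Sum>j | j \<in> tree_nodes m \<and> length j = n.
            dissipation_fraction f (node_coeff \<alpha> d) (constant_solution m \<alpha> f d \<Omega> \<delta>) j
              * indicator B (rcm_sigma d j)) \<longlonglongrightarrow> 1"
  using repeated_coefficients_model.dissipation_concentrates [OF assms]
  by (simp only: tree_level_def)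

end
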